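(* Let $(\mathfrak g,B)$ be a diagonalizable reduced singular quadratic Lie algebra. Then $\mathfrak g$ is an amalgamated product of singular quadratic Lie algebras all i-isomorphic to $\mathfrak g_4$.
   Context: All vector spaces are finite-dimensional over $\mathbb C$. A quadratic Lie algebra $(\mathfrak g,B)$ is a Lie algebra with a non-degenerate symmetric invariant bilinear form. An i-isomorphism is a Lie algebra isomorphism that is an isometry. Let $I(X,Y,Z)=B([X,Y],Z)$ and $\mathrm{dup}(\mathfrak g)=\dim\{\alpha\in\mathfrak g^*\mid\alpha\wedge I=0\}$; a non-Abelian quadratic Lie algebra is singular if $\mathrm{dup}(\mathfrak g)\ge1$. A quadratic Lie algebra $\mathfrak g\neq\{0\}$ is reduced if its center is totally isotropic. Double extension of a quadratic vector space $(\mathfrak q,B_{\mathfrak q})$ (non-degenerate symmetric form) by a skew-symmetric map $\overline C$: the orthogonal direct sum $(\mathbb CX_0\oplus\mathbb CY_0)\oplus\mathfrak q$, with form $B$ extending $B_{\mathfrak q}$ and $B(X_0,X_0)=B(Y_0,Y_0)=0$, $B(X_0,Y_0)=1$, and bracket $[X+\lambda X_0+\mu Y_0,\,Y+\lambda'X_0+\mu'Y_0]=\mu\overline C(Y)-\mu'\overline C(X)+B(\overline C(X),Y)X_0$ for $X,Y\in\mathfrak q$. Every solvable singular quadratic Lie algebra can be written as a double extension with $\overline C=\mathrm{ad}(Y_0)|_{\mathfrak q}$; it is called diagonalizable if $\overline C$ is diagonalizable (independent of the decomposition). A diagonalizable singular quadratic Lie algebra is in particular solvable by definition. The amalgamated product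 of double extensions $\mathfrak g_i$ of $\mathfrak q_i$ by $\overline C_i$ ($1\le i\le k$) is the double extension of the orthogonal direct sum $\mathfrak q_1\oplus\dots\oplus\mathfrak q_k$ by $\overline C=\overline C_1\oplus\dots\oplus\overline C_k$. $\mathfrak g_4$ is the double extension of $\mathbb C^2$, with basis $\{E_1,E_2\}$ and form $B(E_1,E_1)=B(E_2,E_2)=0$, $B(E_1,E_2)=1$, by $\begin{pmatrix}1&0\\0&-1\end{pmatrix}$. *)

theory Defs
  imports "HOL-Analysis.Analysis" "HOL-Library.Function_Algebras"
begin

section \<open>Complex vector spaces\<close>

text \<open>
  The ambient types carry the linear structure; the vector spaces under consideration are
  finite-dimensional subspaces of such types.  This allows direct sums of a varying number of
  spaces to be formed inside one function type.
\<close>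

class complex_vector = ab_group_add +
  fixes scaleC :: "complex \<Rightarrow> 'a \<Rightarrow> 'a" (infixr \<open>*\<^sub>C\<close> 75)
  assumes scaleC_add_right: "a *\<^sub>C (x + y) = a *\<^sub>C x + a *\<^sub>C y"
    and scaleC_add_left: "(a + b) *\<^sub>C x = a *\<^sub>C x + b *\<^sub>C x"
    and scaleC_scaleC: "a *\<^sub>C b *\<^sub>C x = (a * b) *\<^sub>C x"
    and scaleC_one: "1 *\<^sub>C x = x"

global_interpretation complex_vector: vector_space "scaleC :: complex \<Rightarrow> 'a \<Rightarrow> 'a::complex_vector"
  by unfold_locales
    (simp_all add: scaleC_add_right scaleC_add_left scaleC_scaleC scaleC_one)

instantiation complex :: complex_vector
begin
definition scaleC_complex :: "complex \<Rightarrow> complex \<Rightarrow> complex" where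
  "scaleC_complex a x = a * x"
instance by standard (simp_all add: scaleC_complex_def algebra_simps)
end

instantiation prod :: (complex_vector, complex_vector) complex_vector
begin
definition scaleC_prod :: "complex \<Rightarrow> 'a \<times> 'b \<Rightarrow> 'a \<times> 'b" where
  "scaleC_prod a p = (a *\<^sub>C fst p, a *\<^sub>C snd p)"
instance
  by standard
    (simp_all add: scaleC_prod_def prod_eq_iff
      scaleC_add_right scaleC_add_left scaleC_scaleC scaleC_one)
end

instantiation "fun" :: (type, complex_vector) complex_vector
begin
definition scaleC_fun :: "complex \<Rightarrow> ('a \<Rightarrow> 'b) \<Rightarrow> 'a \<Rightarrow> 'b" where
  "scaleC_fun a f = (\<lambda>x. a *\<^sub>C f x)"
instance
  by standard
    (simp_all add: scaleC_fun_def fun_eq_iff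
      scaleC_add_right scaleC_add_left scaleC_scaleC scaleC_one)
end

instantiation vec :: (complex_vector, finite) complex_vector
begin
definition scaleC_vec :: "complex \<Rightarrow> 'a ^ 'b \<Rightarrow> 'a ^ 'b" where
  "scaleC_vec a v = (\<chi> i. a *\<^sub>C (v $ i))"
instance
  by standard
    (simp_all add: scaleC_vec_def vec_eq_iff
      scaleC_add_right scaleC_add_left scaleC_scaleC scaleC_one)
end

definition clinear_on :: "'a::complex_vector set \<Rightarrow> ('a \<Rightarrow> 'b::complex_vector) \<Rightarrow> bool" where
  "clinear_on V f \<longleftrightarrow>
     (\<forall>x\<in>V. \<forall>y\<in>V. f (x + y) = f x + f y) \<and> (\<forall>c. \<forall>x\<in>V. f (c *\<^sub>C x) = c *\<^sub>C f x)"

definition finite_dim :: "'a::complex_vector set \<Rightarrow> bool" where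
  "finite_dim V \<longleftrightarrow> (\<exists>S. finite S \<and> V = complex_vector.span S)"

text \<open>Linear forms on a subspace are extended by zero, so that each is a unique function.\<close>

definition dual_space :: "'a::complex_vector set \<Rightarrow> ('a \<Rightarrow> complex) set" where
  "dual_space V = {\<alpha>. clinear_on V \<alpha> \<and> (\<forall>x. x \<notin> V \<longrightarrow> \<alpha> x = 0)}"

definition diagonalizable_on :: "'a::complex_vector set \<Rightarrow> ('a \<Rightarrow> 'a) \<Rightarrow> bool" where
  "diagonalizable_on V C \<longleftrightarrow>
     (\<exists>S. complex_vector.independent S \<and> complex_vector.span S = V \<and>
          (\<forall>v\<in>S. \<exists>c. C v = c *\<^sub>C v))"


section \<open>Quadratic vector spaces and quadratic Lie algebras\<close>

record 'v quad_space =
  carrier :: "'v set"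
  form :: "'v \<Rightarrow> 'v \<Rightarrow> complex"

record 'v quad_lie = "'v quad_space" +
  bracket :: "'v \<Rightarrow> 'v \<Rightarrow> 'v"

locale quadratic_space =
  fixes Q :: "('v::complex_vector, 'm) quad_space_scheme"
  assumes finite_dim: "finite_dim (carrier Q)"
    and form_linear: "\<And>x. x \<in> carrier Q \<Longrightarrow> clinear_on (carrier Q) (form Q x)"
    and form_sym: "\<And>x y. x \<in> carrier Q \<Longrightarrow> y \<in> carrier Q \<Longrightarrow> form Q x y = form Q y x"
    and form_nondegenerate:
      "\<And>x. x \<in> carrier Q \<Longrightarrow> (\<And>y. y \<in> carrier Q \<Longrightarrow> form Q x y = 0) \<Longrightarrow> x = 0"

locale quadratic_lie_algebra = quadratic_space g
  for g :: "('v::complex_vector, 'm) quad_lie_scheme" +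
  assumes bracket_closed:
      "\<And>x y. x \<in> carrier g \<Longrightarrow> y \<in> carrier g \<Longrightarrow> bracket g x y \<in> carrier g"
    and bracket_linear_right:
      "\<And>x. x \<in> carrier g \<Longrightarrow> clinear_on (carrier g) (bracket g x)"
    and bracket_linear_left:
      "\<And>y. y \<in> carrier g \<Longrightarrow> clinear_on (carrier g) (\<lambda>x. bracket g x y)"
    and bracket_alternating: "\<And>x. x \<in> carrier g \<Longrightarrow> bracket g x x = 0"
    and jacobi:
      "\<And>x y z. x \<in> carrier g \<Longrightarrow> y \<in> carrier g \<Longrightarrow> z \<in> carrier g \<Longrightarrow>
         bracket g x (bracket g y z) + bracket g y (bracket g z x) + bracket g z (bracket g x y) = 0"
    and form_invariant:
      "\<And>x y z. x \<in> carrier g \<Longrightarrow> y \<in> carrier g \<Longrightarrow> z \<in> carrier g \<Longrightarrow>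
         form g (bracket g x y) z = form g x (bracket g y z)"

definition i_isomorphism ::
    "('v::complex_vector) quad_lie \<Rightarrow> ('w::complex_vector) quad_lie \<Rightarrow> ('v \<Rightarrow> 'w) \<Rightarrow> bool" where
  "i_isomorphism g h \<phi> \<longleftrightarrow>
     bij_betw \<phi> (carrier g) (carrier h) \<and> clinear_on (carrier g) \<phi> \<and>
     (\<forall>x\<in>carrier g. \<forall>y\<in>carrier g. \<phi> (bracket g x y) = bracket h (\<phi> x) (\<phi> y)) \<and>
     (\<forall>x\<in>carrier g. \<forall>y\<in>carrier g. form h (\<phi> x) (\<phi> y) = form g x y)"

definition i_isomorphic ::
    "('v::complex_vector) quad_lie \<Rightarrow> ('w::complex_vector) quad_lie \<Rightarrow> bool" where
  "i_isomorphic g h \<longleftrightarrow> (\<exists>\<phi>. i_isomorphism g h \<phi>)"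

definition abelian :: "('v::complex_vector) quad_lie \<Rightarrow> bool" where
  "abelian g \<longleftrightarrow> (\<forall>x\<in>carrier g. \<forall>y\<in>carrier g. bracket g x y = 0)"

definition center :: "('v::complex_vector) quad_lie \<Rightarrow> 'v set" where
  "center g = {x \<in> carrier g. \<forall>y\<in>carrier g. bracket g x y = 0}"

definition is_reduced :: "('v::complex_vector) quad_lie \<Rightarrow> bool" where
  "is_reduced g \<longleftrightarrow> carrier g \<noteq> {0} \<and> (\<forall>x\<in>center g. \<forall>y\<in>center g. form g x y = 0)"

primrec derived_series :: "('v::complex_vector) quad_lie \<Rightarrow> nat \<Rightarrow> 'v set" where
  "derived_series g 0 = carrier g"
| "derived_series g (Suc n) =
     complex_vector.span {bracket g x y |x y. x \<in> derived_series g n \<and> y \<in> derived_series g n}"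

definition solvable :: "('v::complex_vector) quad_lie \<Rightarrow> bool" where
  "solvable g \<longleftrightarrow> (\<exists>n. derived_series g n = {0})"

definition three_form :: "('v::complex_vector) quad_lie \<Rightarrow> 'v \<Rightarrow> 'v \<Rightarrow> 'v \<Rightarrow> complex" where
  "three_form g x y z = form g (bracket g x y) z"

text \<open>The exterior product of a linear form and an alternating 3-form, as a sum over shuffles.\<close>

definition wedge_1_3 ::
    "('v \<Rightarrow> complex) \<Rightarrow> ('v \<Rightarrow> 'v \<Rightarrow> 'v \<Rightarrow> complex) \<Rightarrow> 'v \<Rightarrow> 'v \<Rightarrow> 'v \<Rightarrow> 'v \<Rightarrow> complex" where
  "wedge_1_3 \<alpha> I w x y z = \<alpha> w * I x y z - \<alpha> x * I w y z + \<alpha> y * I w x z - \<alpha> z * I w x y"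

definition dup :: "('v::complex_vector) quad_lie \<Rightarrow> nat" where
  "dup g = complex_vector.dim
     {\<alpha> \<in> dual_space (carrier g).
        \<forall>w\<in>carrier g. \<forall>x\<in>carrier g. \<forall>y\<in>carrier g. \<forall>z\<in>carrier g.
          wedge_1_3 \<alpha> (three_form g) w x y z = 0}"

definition singular_quadratic_lie_algebra :: "('v::complex_vector) quad_lie \<Rightarrow> bool" where
  "singular_quadratic_lie_algebra g \<longleftrightarrow>
     quadratic_lie_algebra g \<and> \<not> abelian g \<and> dup g \<ge> 1"


section \<open>Double extensions and amalgamated products\<close>

definition skew_symmetric_map ::
    "('v::complex_vector, 'm) quad_space_scheme \<Rightarrow> ('v \<Rightarrow> 'v) \<Rightarrow> bool" where
  "skew_symmetric_map Q C \<longleftrightarrow>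
     (\<forall>x\<in>carrier Q. C x \<in> carrier Q) \<and> clinear_on (carrier Q) C \<and>
     (\<forall>x\<in>carrier Q. \<forall>y\<in>carrier Q. form Q (C x) y = - form Q x (C y))"

text \<open>The triple \<open>(l, m, x)\<close> stands for \<open>x + l X\<^sub>0 + m Y\<^sub>0\<close>.\<close>

definition double_extension ::
    "('v::complex_vector) quad_space \<Rightarrow> ('v \<Rightarrow> 'v) \<Rightarrow> (complex \<times> complex \<times> 'v) quad_lie" where
  "double_extension Q C =
     \<lparr> carrier = UNIV \<times> UNIV \<times> carrier Q,
       form = (\<lambda>(l, m, x) (l', m', y). l * m' + m * l' + form Q x y),
       bracket = (\<lambda>(l, m, x) (l', m', y). (form Q (C x) y, 0, m *\<^sub>C C y - m' *\<^sub>C C x)) \<rparr>"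

text \<open>
  The internal decomposition of \<open>g\<close> as the double extension of \<open>W\<close>, with the restricted form,
  by \<open>ad(Y\<^sub>0)\<close> restricted to \<open>W\<close>.
\<close>

definition is_double_extension_of ::
    "('v::complex_vector) quad_lie \<Rightarrow> 'v \<Rightarrow> 'v \<Rightarrow> 'v set \<Rightarrow> bool" where
  "is_double_extension_of g X0 Y0 W \<longleftrightarrow>
     (let Q = \<lparr> carrier = W, form = form g \<rparr>; C = bracket g Y0 in
        quadratic_space Q \<and> skew_symmetric_map Q C \<and>
        i_isomorphism (double_extension Q C) g (\<lambda>(l, m, x). x + l *\<^sub>C X0 + m *\<^sub>C Y0))"

definition diagonalizable :: "('v::complex_vector) quad_lie \<Rightarrow> bool" where
  "diagonalizable g \<longleftrightarrow>
     solvable g \<and>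
     (\<exists>X0 Y0 W. is_double_extension_of g X0 Y0 W \<and> diagonalizable_on W (bracket g Y0))"

definition orthogonal_sum :: "nat \<Rightarrow> (nat \<Rightarrow> ('v::complex_vector) quad_space) \<Rightarrow> (nat \<Rightarrow> 'v) quad_space" where
  "orthogonal_sum k Q =
     \<lparr> carrier = {f. (\<forall>i<k. f i \<in> carrier (Q i)) \<and> (\<forall>i\<ge>k. f i = 0)},
       form = (\<lambda>f h. \<Sum>i<k. form (Q i) (f i) (h i)) \<rparr>"

definition direct_sum_map :: "nat \<Rightarrow> (nat \<Rightarrow> 'v \<Rightarrow> 'v) \<Rightarrow> (nat \<Rightarrow> 'v) \<Rightarrow> nat \<Rightarrow> 'v::complex_vector" where
  "direct_sum_map k C f = (\<lambda>i. if i < k then C i (f i) else 0)"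

definition amalgamated_product ::
    "nat \<Rightarrow> (nat \<Rightarrow> ('v::complex_vector) quad_space) \<Rightarrow> (nat \<Rightarrow> 'v \<Rightarrow> 'v) \<Rightarrow>
      (complex \<times> complex \<times> (nat \<Rightarrow> 'v)) quad_lie" where
  "amalgamated_product k Q C = double_extension (orthogonal_sum k Q) (direct_sum_map k C)"

definition g4 :: "(complex \<times> complex \<times> (complex ^ 2)) quad_lie" where
  "g4 = double_extension
          \<lparr> carrier = UNIV, form = (\<lambda>x y. x $ 1 * y $ 2 + x $ 2 * y $ 1) \<rparr>
          (\<lambda>v. vector [vector [1, 0], vector [0, -1]] *v v)"

end

theory Submission
  imports Defs
begin

text \<open>
  Write \<open>g\<close> as a double extension of \<open>W\<close> by \<open>C = ad(Y\<^sub>0)\<close>.  A vector of \<open>W\<close> killed by \<open>C\<close>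
  commutes with all of \<open>g\<close>, so reducedness makes the kernel of \<open>C\<close> totally isotropic.  On the
  other hand, skew-symmetry makes eigenvectors of \<open>C\<close> with eigenvalues \<open>a\<close> and \<open>b\<close> orthogonal
  unless \<open>a + b = 0\<close>.  Hence an eigenvector \<open>u\<close> must pair non-trivially with another eigenvector
  \<open>v\<close> of the opposite eigenvalue, and that eigenvalue is not \<open>0\<close>, for otherwise \<open>u\<close> and \<open>v\<close>
  would both lie in the isotropic kernel.  After rescaling, \<open>u\<close> and \<open>v\<close> form a hyperbolic pair
  spanning a \<open>C\<close>-stable plane.  Splitting off such planes until \<open>W\<close> is exhausted yields an
  orthogonal decomposition (\<open>exists_complete_hyperbolic_system\<close>) whose coordinates identify \<open>g\<close>
  with an amalgamated product (\<open>double_extension_amalgamated\<close>).  There is at least one plane,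
  since \<open>W = 0\<close> would make \<open>g\<close> Abelian.

  On each plane \<open>C\<close> is \<open>diag(c, -c)\<close> with \<open>c \<noteq> 0\<close>, and replacing \<open>Y\<^sub>0\<close> by \<open>Y\<^sub>0 / c\<close> and \<open>X\<^sub>0\<close> by
  \<open>c X\<^sub>0\<close> normalizes \<open>c\<close> to \<open>1\<close> without changing the form; this is the isomorphism onto \<open>g\<^sub>4\<close>
  (\<open>double_extension_plane_g4\<close>).  Each factor is singular because the three-form of any double
  extension is divisible by the \<open>Y\<^sub>0\<close>-coordinate (\<open>singular_double_extension\<close>).
\<close>

section \<open>Linear maps on subspaces\<close>

lemma clinear_onI:
  assumes "\<And>x y. x \<in> V \<Longrightarrow> y \<in> V \<Longrightarrow> f (x + y) = f x + f y"
    and "\<And>a x. x \<in> V \<Longrightarrow> f (a *\<^sub>C x) = a *\<^sub>C f x"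
  shows "clinear_on V f"
  using assms unfolding clinear_on_def by blast

lemma clinear_on_add: "clinear_on V f \<Longrightarrow> x \<in> V \<Longrightarrow> y \<in> V \<Longrightarrow> f (x + y) = f x + f y"
  unfolding clinear_on_def by blast

lemma clinear_on_scale: "clinear_on V f \<Longrightarrow> x \<in> V \<Longrightarrow> f (a *\<^sub>C x) = a *\<^sub>C f x"
  unfolding clinear_on_def by blast

lemma clinear_on_zero: "clinear_on V f \<Longrightarrow> 0 \<in> V \<Longrightarrow> f 0 = 0"
  using clinear_on_scale[of V f 0 0] by simp

lemma clinear_on_diff:
  assumes f: "clinear_on V f" and V: "complex_vector.subspace V" and "x \<in> V" "y \<in> V"
  shows "f (x - y) = f x - f y"
proof -
  have "f x = f (x - y) + f y"
    using clinear_on_add[OF f complex_vector.subspace_diff[OF V assms(3,4)] assms(4)] by simp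
  then show ?thesis by simp
qed

lemma clinear_on_minus: "clinear_on V f \<Longrightarrow> x \<in> V \<Longrightarrow> f (- x) = - f x"
  using clinear_on_scale[of V f x "- 1"] by (simp add: scaleC_one)

lemma clinear_on_sum:
  assumes f: "clinear_on V f" and V: "complex_vector.subspace V" and "\<And>i. i \<in> A \<Longrightarrow> u i \<in> V"
  shows "f (\<Sum>i\<in>A. u i) = (\<Sum>i\<in>A. f (u i))"
  using assms(3)
proof (induction A rule: infinite_finite_induct)
  case (insert a A)
  then show ?case
    by (simp add: clinear_on_add[OF f] complex_vector.subspace_sum[OF V])
qed (simp_all add: clinear_on_zero[OF f complex_vector.subspace_0[OF V]])

lemma clinear_on_eq_zero_on_span:
  assumes f: "clinear_on (complex_vector.span S) f" and S: "\<And>s. s \<in> S \<Longrightarrow> f s = 0"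
    and x: "x \<in> complex_vector.span S"
  shows "f x = 0"
proof -
  let ?K = "{x \<in> complex_vector.span S. f x = 0}"
  have "complex_vector.subspace ?K"
    unfolding complex_vector.subspace_def
    by (auto simp: clinear_on_add[OF f] clinear_on_scale[OF f]
        clinear_on_zero[OF f complex_vector.span_zero]
        intro: complex_vector.span_zero complex_vector.span_add complex_vector.span_scale)
  moreover have "S \<subseteq> ?K" using S by (auto intro: complex_vector.span_base)
  ultimately show ?thesis using x complex_vector.span_minimal[of S ?K] by blast
qed

lemma scaleC_Pair: "a *\<^sub>C (x, y) = (a *\<^sub>C x, a *\<^sub>C y)"
  by (simp add: scaleC_prod_def)

lemma subspace_finite_dim: "finite_dim V \<Longrightarrow> complex_vector.subspace V"
  unfolding finite_dim_def by auto

text \<open>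
  The coordinate forms of a basis of \<open>V\<close>, extended by zero outside \<open>V\<close>, span the dual space.
\<close>

lemma finite_dim_dual_space:
  assumes "finite_dim V"
  shows "\<exists>S. finite S \<and> dual_space V \<subseteq> complex_vector.span S"
proof -
  obtain S where S: "finite S" "V = complex_vector.span S"
    using assms unfolding finite_dim_def by blast
  obtain B where B: "B \<subseteq> S" "complex_vector.independent B" "S \<subseteq> complex_vector.span B"
    using complex_vector.maximal_independent_subset by blast
  have V: "V = complex_vector.span B"
    using S B by (metis complex_vector.span_mono complex_vector.span_span subset_antisym)
  have finB: "finite B" using B S finite_subset by blast
  define coord where
    "coord b x = (if x \<in> V then complex_vector.representation B x b else 0)" for b x
  have "\<alpha> \<in> complex_vector.span (coord ` B)" if \<alpha>: "\<alpha> \<in> dual_space V" for \<alpha>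
  proof -
    have lin: "clinear_on V \<alpha>" and out: "\<And>x. x \<notin> V \<Longrightarrow> \<alpha> x = 0"
      using \<alpha> unfolding dual_space_def by auto
    have sub: "complex_vector.subspace V" unfolding V by simp
    have "\<alpha> = (\<Sum>b\<in>B. \<alpha> b *\<^sub>C coord b)"
    proof
      fix x
      have ap: "(\<Sum>b\<in>B. \<alpha> b *\<^sub>C coord b) x = (\<Sum>b\<in>B. \<alpha> b * coord b x)"
        using finB by (induction B rule: finite_induct) (auto simp: scaleC_fun_def scaleC_complex_def)
      show "\<alpha> x = (\<Sum>b\<in>B. \<alpha> b *\<^sub>C coord b) x"
      proof (cases "x \<in> V")
        case True
        have BV: "b \<in> V" if "b \<in> B" for b using that V complex_vector.span_base by auto
        have "\<alpha> x = \<alpha> (\<Sum>b\<in>B. complex_vector.representation B x b *\<^sub>C b)"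
          using complex_vector.sum_representation_eq[OF B(2) _ finB order_refl] True V by simp
        also have "\<dots> = (\<Sum>b\<in>B. \<alpha> (complex_vector.representation B x b *\<^sub>C b))"
          by (rule clinear_on_sum[OF lin sub]) (simp add: BV complex_vector.subspace_scale[OF sub])
        also have "\<dots> = (\<Sum>b\<in>B. \<alpha> b * coord b x)"
          using True by (intro sum.cong refl)
            (simp add: clinear_on_scale[OF lin] BV coord_def scaleC_complex_def)
        finally show ?thesis using ap by simp
      qed (use ap out in \<open>simp add: coord_def\<close>)
    qed
    also have "\<dots> \<in> complex_vector.span (coord ` B)"
      by (intro complex_vector.span_sum complex_vector.span_scale complex_vector.span_base) auto
    finally show ?thesis .
  qed
  then show ?thesis using finB by blast
qed

text \<open>
  The finite spanning set is essential: by convention, \<open>dim T = 0\<close> when the span of \<open>T\<close> is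
  infinite-dimensional.
\<close>

lemma dim_ge_1:
  assumes "finite S" "T \<subseteq> complex_vector.span S" "x \<in> T" "x \<noteq> 0"
  shows "complex_vector.dim T \<ge> 1"
proof -
  obtain B where B: "B \<subseteq> T" "complex_vector.independent B" "T \<subseteq> complex_vector.span B"
    "card B = complex_vector.dim T"
    using complex_vector.basis_exists by blast
  have "finite B"
    using complex_vector.independent_span_bound[OF assms(1) B(2)] B(1) assms(2) by blast
  moreover have "B \<noteq> {}" using B(3) assms(3,4) by auto
  ultimately show ?thesis using B(4) by (metis One_nat_def Suc_leI card_gt_0_iff)
qed

context quadratic_space
begin

lemma carrier_subspace: "complex_vector.subspace (carrier Q)"
  by (rule subspace_finite_dim[OF finite_dim])

lemmas carrier_closed [simp, intro] =
  complex_vector.subspace_0[OF carrier_subspace]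
  complex_vector.subspace_add[OF carrier_subspace]
  complex_vector.subspace_diff[OF carrier_subspace]
  complex_vector.subspace_neg[OF carrier_subspace]
  complex_vector.subspace_scale[OF carrier_subspace]

lemma form_clinear_left: "y \<in> carrier Q \<Longrightarrow> clinear_on (carrier Q) (\<lambda>x. form Q x y)"
  by (rule clinear_onI)
    (simp_all add: form_sym[of _ y] clinear_on_add[OF form_linear] clinear_on_scale[OF form_linear])

lemmas form_simps =
  clinear_on_add[OF form_linear] clinear_on_add[OF form_clinear_left]
  clinear_on_diff[OF form_linear carrier_subspace]
  clinear_on_diff[OF form_clinear_left carrier_subspace]
  clinear_on_scale[OF form_linear] clinear_on_scale[OF form_clinear_left]
  clinear_on_minus[OF form_linear] clinear_on_minus[OF form_clinear_left]
  clinear_on_zero[OF form_linear] clinear_on_zero[OF form_clinear_left]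
  scaleC_complex_def

end


section \<open>Double extensions are quadratic Lie algebras\<close>

locale skew_quadratic_space = quadratic_space Q
  for Q :: "('v::complex_vector) quad_space" +
  fixes C :: "'v \<Rightarrow> 'v"
  assumes skew_map: "skew_symmetric_map Q C"
begin

lemma map_closed [simp, intro]: "x \<in> carrier Q \<Longrightarrow> C x \<in> carrier Q"
  and map_linear: "clinear_on (carrier Q) C"
  and skew: "x \<in> carrier Q \<Longrightarrow> y \<in> carrier Q \<Longrightarrow> form Q (C x) y = - form Q x (C y)"
  using skew_map unfolding skew_symmetric_map_def by blast+

lemmas map_simps =
  clinear_on_add[OF map_linear] clinear_on_scale[OF map_linear] clinear_on_minus[OF map_linear]
  clinear_on_diff[OF map_linear carrier_subspace] clinear_on_zero[OF map_linear]

lemma skew_swap: "x \<in> carrier Q \<Longrightarrow> y \<in> carrier Q \<Longrightarrow> form Q (C x) y = - form Q (C y) x"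
  using skew[of x y] form_sym[of x "C y"] by simp

lemma form_map_self: "x \<in> carrier Q \<Longrightarrow> form Q (C x) x = 0"
  using skew_swap[of x x] by simp

abbreviation "DE \<equiv> double_extension Q C"

lemma DE_carrier: "carrier DE = UNIV \<times> UNIV \<times> carrier Q"
  and DE_form: "form DE (l, m, x) (l', m', y) = l * m' + m * l' + form Q x y"
  and DE_bracket: "bracket DE (l, m, x) (l', m', y) = (form Q (C x) y, 0, m *\<^sub>C C y - m' *\<^sub>C C x)"
  by (simp_all add: double_extension_def)

lemmas DE_simps = DE_carrier DE_form DE_bracket scaleC_Pair

lemma double_extension_finite_dim: "finite_dim (carrier DE)"
proof -
  obtain S where S: "finite S" "carrier Q = complex_vector.span S"
    using finite_dim unfolding finite_dim_def by blast
  let ?T = "{(1, 0, 0), (0, 1, 0)} \<union> (\<lambda>x. (0, 0, x)) ` S :: (complex \<times> complex \<times> 'v) set"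
  have sub: "complex_vector.subspace (carrier DE)"
    unfolding complex_vector.subspace_def
    by (auto simp: DE_carrier scaleC_Pair zero_prod_def)
  have q: "(0, 0, x) \<in> complex_vector.span ?T" if "x \<in> complex_vector.span S" for x
    using that
  proof (induction rule: complex_vector.span_induct_alt)
    case base
    show ?case using complex_vector.span_zero[of ?T] by (simp add: zero_prod_def)
  next
    case (step a s y)
    have "a *\<^sub>C (0, 0, s) + (0, 0, y) \<in> complex_vector.span ?T"
      using step by (intro complex_vector.span_add complex_vector.span_scale)
        (auto intro: complex_vector.span_base)
    then show ?case by (simp add: scaleC_Pair)
  qed
  have "(l, m, x) \<in> complex_vector.span ?T" if "x \<in> carrier Q" for l m x
  proof -
    have "l *\<^sub>C (1, 0, 0) + m *\<^sub>C (0, 1, 0) + (0, 0, x) \<in> complex_vector.span ?T"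
      using q that S(2) by (intro complex_vector.span_add complex_vector.span_scale)
        (auto intro: complex_vector.span_base)
    then show ?thesis by (simp add: scaleC_Pair scaleC_complex_def)
  qed
  moreover have "?T \<subseteq> carrier DE"
    using S(2) by (auto simp: DE_carrier intro: complex_vector.span_base)
  ultimately have "carrier DE = complex_vector.span ?T"
    using complex_vector.span_minimal[OF _ sub, of ?T] by (auto simp: DE_carrier)
  moreover have "finite ?T" using S(1) by simp
  ultimately show ?thesis unfolding finite_dim_def by (intro exI[of _ ?T] conjI)
qed

text \<open>
  Since \<open>ad\<close> of a vector of \<open>Q\<close> maps \<open>Q\<close> into the central line \<open>\<complex>X\<^sub>0\<close>, only terms with two
  factors \<open>C\<close> survive: multiples of \<open>C\<^sup>2\<close> cancel in pairs, and the coefficients of \<open>X\<^sub>0\<close> cancel by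
  the symmetry of the form on vectors \<open>C x\<close>.
\<close>

lemma double_extension_jacobi:
  assumes "x \<in> carrier DE" "y \<in> carrier DE" "z \<in> carrier DE"
  shows "bracket DE x (bracket DE y z) + bracket DE y (bracket DE z x)
    + bracket DE z (bracket DE x y) = 0"
proof -
  obtain l m a l' m' b l'' m'' d where xyz: "x = (l, m, a)" "y = (l', m', b)" "z = (l'', m'', d)"
    by (cases x, cases y, cases z) auto
  have abd: "a \<in> carrier Q" "b \<in> carrier Q" "d \<in> carrier Q"
    using assms by (auto simp: xyz DE_carrier)
  have sym: "form Q (C b) (C a) = form Q (C a) (C b)" "form Q (C d) (C a) = form Q (C a) (C d)"
    "form Q (C d) (C b) = form Q (C b) (C d)"
    using abd by (auto intro: form_sym)
  show ?thesis
    using abd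
    by (simp add: xyz DE_bracket form_simps map_simps sym zero_prod_def
        complex_vector.scale_right_diff_distrib scaleC_scaleC mult.commute)
qed

lemma quadratic_lie_algebra_double_extension: "quadratic_lie_algebra DE"
proof
  show "finite_dim (carrier DE)" by (rule double_extension_finite_dim)
next
  fix x assume x: "x \<in> carrier DE"
  then show "clinear_on (carrier DE) (form DE x)"
    by (intro clinear_onI) (auto simp: DE_simps form_simps algebra_simps)
  show "clinear_on (carrier DE) (bracket DE x)"
    using x by (intro clinear_onI)
      (auto simp: DE_simps form_simps map_simps algebra_simps)
  show "clinear_on (carrier DE) (\<lambda>y. bracket DE y x)"
    using x by (intro clinear_onI)
      (auto simp: DE_simps form_simps map_simps algebra_simps)
  show "bracket DE x x = 0"
    using x by (auto simp: DE_simps form_map_self zero_prod_def)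
  show "x = 0" if "\<And>y. y \<in> carrier DE \<Longrightarrow> form DE x y = 0"
  proof -
    obtain l m a where xa: "x = (l, m, a)" "a \<in> carrier Q"
      using x by (cases x) (auto simp: DE_carrier)
    have "l = 0" using that[of "(0, 1, 0)"] xa by (simp add: DE_simps form_simps)
    moreover have "m = 0" using that[of "(1, 0, 0)"] xa by (simp add: DE_simps form_simps)
    moreover have "form Q a y = 0" if "y \<in> carrier Q" for y
      using \<open>\<And>y. y \<in> carrier DE \<Longrightarrow> form DE x y = 0\<close>[of "(0, 0, y)"] that xa
      by (simp add: DE_simps)
    ultimately show ?thesis using form_nondegenerate xa by (simp add: zero_prod_def)
  qed
next
  fix x y assume "x \<in> carrier DE" "y \<in> carrier DE"
  then show "form DE x y = form DE y x" "bracket DE x y \<in> carrier DE"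
    by (auto simp: DE_simps form_sym)
next
  fix x y z assume xyz: "x \<in> carrier DE" "y \<in> carrier DE" "z \<in> carrier DE"
  then show "form DE (bracket DE x y) z = form DE x (bracket DE y z)"
    by (auto simp: DE_simps form_simps skew algebra_simps)
  show "bracket DE x (bracket DE y z) + bracket DE y (bracket DE z x)
    + bracket DE z (bracket DE x y) = 0"
    by (rule double_extension_jacobi[OF xyz])
qed

text \<open>
  The three-form is \<open>\<alpha> \<and> \<Omega>\<close>, where \<open>\<alpha>\<close> is the \<open>Y\<^sub>0\<close>-coordinate and \<open>\<Omega>(x, y) = B(C x, y)\<close>;
  hence \<open>\<alpha> \<and> I = \<alpha> \<and> \<alpha> \<and> \<Omega> = 0\<close>.
\<close>

lemma singular_double_extension:
  assumes v: "v \<in> carrier Q" "C v \<noteq> 0"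
  shows "singular_quadratic_lie_algebra DE"
proof -
  \<comment> \<open>The bracket of \<open>Y\<^sub>0\<close> with \<open>v\<close> is \<open>C v\<close>.\<close>
  have "bracket DE (0, 1, 0) (0, 0, v) \<noteq> 0"
    using v by (simp add: DE_simps zero_prod_def scaleC_one)
  then have na: "\<not> abelian DE"
    using v unfolding abelian_def by (force simp: DE_carrier)
  define \<alpha> where "\<alpha> p = (if p \<in> carrier DE then fst (snd p) else 0)"
    for p :: "complex \<times> complex \<times> 'v"
  let ?T = "{\<alpha> \<in> dual_space (carrier DE).
        \<forall>w\<in>carrier DE. \<forall>x\<in>carrier DE. \<forall>y\<in>carrier DE. \<forall>z\<in>carrier DE.
          wedge_1_3 \<alpha> (three_form DE) w x y z = 0}"
  have "\<alpha> \<in> dual_space (carrier DE)"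
    unfolding dual_space_def clinear_on_def
    by (auto simp: \<alpha>_def DE_simps scaleC_complex_def)
  moreover have "wedge_1_3 \<alpha> (three_form DE) w x y z = 0"
    if mem: "w \<in> carrier DE" "x \<in> carrier DE" "y \<in> carrier DE" "z \<in> carrier DE" for w x y z
  proof -
    obtain l1 m1 a1 l2 m2 a2 l3 m3 a3 l4 m4 a4
      where wxyz: "w = (l1, m1, a1)" "x = (l2, m2, a2)" "y = (l3, m3, a3)" "z = (l4, m4, a4)"
      by (cases w, cases x, cases y, cases z) auto
    have a: "a1 \<in> carrier Q" "a2 \<in> carrier Q" "a3 \<in> carrier Q" "a4 \<in> carrier Q"
      using mem by (auto simp: wxyz DE_carrier)
    show ?thesis
      using a by (simp add: wxyz wedge_1_3_def three_form_def \<alpha>_def DE_simps form_simps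
          skew_swap[of a2 a1] skew_swap[of a3 a1] skew_swap[of a4 a1]
          skew_swap[of a3 a2] skew_swap[of a4 a2] skew_swap[of a4 a3] algebra_simps)
  qed
  ultimately have "\<alpha> \<in> ?T" by blast
  moreover have "\<alpha> (0, 1, 0) = 1" by (simp add: \<alpha>_def DE_carrier)
  then have "\<alpha> \<noteq> 0" by (metis zero_fun_apply zero_neq_one)
  moreover obtain S where "finite S" "dual_space (carrier DE) \<subseteq> complex_vector.span S"
    using finite_dim_dual_space[OF double_extension_finite_dim] by blast
  ultimately have "complex_vector.dim ?T \<ge> 1"
    by (intro dim_ge_1[of S]) auto
  then show ?thesis
    using na quadratic_lie_algebra_double_extension
    unfolding singular_quadratic_lie_algebra_def dup_def by blast
qed

end


section \<open>Isomorphisms\<close>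

lemma i_isomorphism_inverse:
  assumes g: "quadratic_lie_algebra g" and \<phi>: "i_isomorphism g h \<phi>"
  shows "i_isomorphism h g (inv_into (carrier g) \<phi>)"
proof -
  interpret quadratic_lie_algebra g by (rule g)
  let ?\<psi> = "inv_into (carrier g) \<phi>"
  have bij: "bij_betw \<phi> (carrier g) (carrier h)" and lin: "clinear_on (carrier g) \<phi>"
    and br: "\<And>x y. x \<in> carrier g \<Longrightarrow> y \<in> carrier g \<Longrightarrow>
      bracket h (\<phi> x) (\<phi> y) = \<phi> (bracket g x y)"
    and fm: "\<And>x y. x \<in> carrier g \<Longrightarrow> y \<in> carrier g \<Longrightarrow> form h (\<phi> x) (\<phi> y) = form g x y"
    using \<phi> unfolding i_isomorphism_def by auto
  have inv: "?\<psi> (\<phi> x) = x" if "x \<in> carrier g" for x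
    using bij_betw_inv_into_left[OF bij that] .
  have onto: "\<exists>x. x \<in> carrier g \<and> y = \<phi> x" if "y \<in> carrier h" for y
    using bij that by (auto simp: bij_betw_def)
  have "?\<psi> (u + v) = ?\<psi> u + ?\<psi> v \<and> ?\<psi> (bracket h u v) = bracket g (?\<psi> u) (?\<psi> v)
      \<and> form g (?\<psi> u) (?\<psi> v) = form h u v"
    if uv: "u \<in> carrier h" "v \<in> carrier h" for u v
  proof -
    obtain x y where xy: "x \<in> carrier g" "y \<in> carrier g" "u = \<phi> x" "v = \<phi> y"
      using onto[OF uv(1)] onto[OF uv(2)] by auto
    then have "u + v = \<phi> (x + y)" by (simp add: clinear_on_add[OF lin])
    then have "?\<psi> (u + v) = x + y" using xy inv by simp
    then show ?thesis using xy by (simp add: inv br fm bracket_closed)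
  qed
  moreover have "?\<psi> (a *\<^sub>C u) = a *\<^sub>C ?\<psi> u" if "u \<in> carrier h" for a u
  proof -
    obtain x where x: "x \<in> carrier g" "u = \<phi> x" using onto[OF \<open>u \<in> carrier h\<close>] by auto
    then have "a *\<^sub>C u = \<phi> (a *\<^sub>C x)" by (simp add: clinear_on_scale[OF lin])
    then show ?thesis using x inv by simp
  qed
  ultimately show ?thesis
    using bij_betw_inv_into[OF bij] unfolding i_isomorphism_def clinear_on_def by simp
qed

lemma i_isomorphism_comp:
  assumes \<phi>: "i_isomorphism g h \<phi>" and \<psi>: "i_isomorphism h k \<psi>"
  shows "i_isomorphism g k (\<psi> \<circ> \<phi>)"
proof -
  have "\<phi> x \<in> carrier h" if "x \<in> carrier g" for x
    using \<phi> that unfolding i_isomorphism_def by (auto dest: bij_betwE)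
  then show ?thesis
    using \<phi> \<psi> bij_betw_trans[of \<phi> "carrier g" "carrier h" \<psi> "carrier k"]
    unfolding i_isomorphism_def clinear_on_def by simp
qed


section \<open>Hyperbolic planes of eigenvectors\<close>

text \<open>
  For a hyperbolic pair \<open>e, f\<close> this is the orthogonal projection onto the plane that it spans.
\<close>

definition plane_proj ::
    "('v::complex_vector, 'm) quad_space_scheme \<Rightarrow> 'v \<Rightarrow> 'v \<Rightarrow> 'v \<Rightarrow> 'v" where
  "plane_proj Q e f x = form Q x f *\<^sub>C e + form Q x e *\<^sub>C f"

definition plane ::
    "('v::complex_vector, 'm) quad_space_scheme \<Rightarrow> 'v \<Rightarrow> 'v \<Rightarrow> 'v quad_space" where
  "plane Q e f = \<lparr> carrier = complex_vector.span {e, f}, form = form Q \<rparr>"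

lemma in_plane_iff: "x \<in> complex_vector.span {e, f} \<longleftrightarrow> (\<exists>a b. x = a *\<^sub>C e + b *\<^sub>C f)"
proof -
  have "x - a *\<^sub>C e = b *\<^sub>C f \<longleftrightarrow> x = a *\<^sub>C e + b *\<^sub>C f" for a b
    by (auto simp: algebra_simps)
  then show ?thesis
    by (simp add: complex_vector.span_breakdown_eq complex_vector.span_singleton image_iff)
qed

locale hyperbolic_eigenpair = skew_quadratic_space Q C
  for Q :: "('v::complex_vector) quad_space" and C +
  fixes e f :: 'v and c :: complex
  assumes e_mem [simp, intro]: "e \<in> carrier Q" and f_mem [simp, intro]: "f \<in> carrier Q"
    and form_ee: "form Q e e = 0" and form_ff: "form Q f f = 0" and form_ef: "form Q e f = 1"
    and eigen_e: "C e = c *\<^sub>C e" and eigen_f: "C f = - c *\<^sub>C f" and c_nonzero: "c \<noteq> 0"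
begin

lemma form_fe: "form Q f e = 1"
  using form_sym[of e f] form_ef by simp

lemmas pair_simps = form_ee form_ff form_ef form_fe form_simps

lemma plane_subset: "complex_vector.span {e, f} \<subseteq> carrier Q"
  by (rule complex_vector.span_minimal[OF _ carrier_subspace]) simp

lemma plane_proj_in_plane: "plane_proj Q e f x \<in> complex_vector.span {e, f}"
  unfolding plane_proj_def in_plane_iff by blast

lemma plane_proj_closed [simp, intro]: "plane_proj Q e f x \<in> carrier Q"
  using plane_proj_in_plane plane_subset by blast

lemma plane_proj_linear: "clinear_on (carrier Q) (plane_proj Q e f)"
  by (rule clinear_onI)
    (simp_all add: plane_proj_def form_simps algebra_simps scaleC_scaleC)

lemma plane_proj_id: "x \<in> complex_vector.span {e, f} \<Longrightarrow> plane_proj Q e f x = x"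
  by (auto simp: in_plane_iff plane_proj_def pair_simps scaleC_one)

lemma form_plane_proj:
  assumes "x \<in> carrier Q"
  shows "form Q (plane_proj Q e f x) e = form Q x e" "form Q (plane_proj Q e f x) f = form Q x f"
  using assms by (simp_all add: plane_proj_def pair_simps)

lemma form_plane_proj_plane_proj:
  assumes "x \<in> carrier Q" "y \<in> carrier Q"
  shows "form Q (plane_proj Q e f x) (plane_proj Q e f y) = form Q (plane_proj Q e f x) y"
  using assms by (simp add: plane_proj_def pair_simps form_sym[of e y] form_sym[of f y])

lemma form_map_e: "x \<in> carrier Q \<Longrightarrow> form Q (C x) e = - c * form Q x e"
  and form_map_f: "x \<in> carrier Q \<Longrightarrow> form Q (C x) f = c * form Q x f"
  by (simp_all add: skew eigen_e eigen_f form_simps)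

lemma map_plane_proj:
  assumes "x \<in> carrier Q"
  shows "C (plane_proj Q e f x) = plane_proj Q e f (C x)"
  using assms
  by (simp add: plane_proj_def map_simps form_map_e form_map_f eigen_e eigen_f scaleC_scaleC
      mult.commute)

lemma skew_quadratic_space_plane: "skew_quadratic_space (plane Q e f) C"
proof
  let ?P = "plane Q e f"
  have car: "carrier ?P = complex_vector.span {e, f}" and fm: "form ?P = form Q"
    by (simp_all add: plane_def)
  note sub = subsetD[OF plane_subset]
  show "finite_dim (carrier ?P)"
    unfolding finite_dim_def car by (rule exI[of _ "{e, f}"]) simp
  show "clinear_on (carrier ?P) (form ?P x)" if "x \<in> carrier ?P" for x
    using that by (intro clinear_onI) (simp_all add: car fm sub form_simps)
  show "form ?P x y = form ?P y x" if "x \<in> carrier ?P" "y \<in> carrier ?P" for x y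
    using that by (simp add: car fm sub form_sym)
  show "x = 0" if x: "x \<in> carrier ?P" and orth: "\<And>y. y \<in> carrier ?P \<Longrightarrow> form ?P x y = 0" for x
  proof -
    have "form Q x e = 0" "form Q x f = 0"
      using orth by (simp_all add: car fm complex_vector.span_base)
    then have "plane_proj Q e f x = 0" by (simp add: plane_proj_def)
    then show ?thesis using plane_proj_id x car by simp
  qed
  have "C x \<in> complex_vector.span {e, f}" if "x \<in> complex_vector.span {e, f}" for x
    using plane_proj_in_plane[of "C x"] map_plane_proj[OF sub[OF that]] plane_proj_id[OF that]
    by simp
  then show "skew_symmetric_map ?P C"
    unfolding skew_symmetric_map_def clinear_on_def
    by (simp add: car fm sub map_simps skew)
qed

text \<open>
  If \<open>X', Y'\<close> denote the distinguished vectors of \<open>g\<^sub>4\<close>, the isomorphism is \<open>e \<mapsto> E\<^sub>1\<close>,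
  \<open>f \<mapsto> E\<^sub>2\<close>, \<open>Y\<^sub>0 \<mapsto> c Y'\<close>, \<open>X\<^sub>0 \<mapsto> X' / c\<close>.  The factor of \<open>Y'\<close> is forced by \<open>[Y\<^sub>0, e] = c e\<close>, and
  that of \<open>X'\<close> by \<open>[e, f] = c X\<^sub>0\<close>; the two are inverse to each other, so \<open>B(X\<^sub>0, Y\<^sub>0) = 1\<close> is
  preserved.
\<close>

lemma double_extension_plane_g4: "i_isomorphic (double_extension (plane Q e f) C) g4"
proof -
  interpret P: skew_quadratic_space "plane Q e f" C by (rule skew_quadratic_space_plane)
  have car: "carrier (plane Q e f) = complex_vector.span {e, f}" and fm: "form (plane Q e f) = form Q"
    by (simp_all add: plane_def)
  note sub = subsetD[OF plane_subset]
  define \<phi> :: "complex \<times> complex \<times> 'v \<Rightarrow> complex \<times> complex \<times> (complex ^ 2)"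
    where "\<phi> = (\<lambda>(l, m, x). (l / c, c * m, vector [form Q x f, form Q x e]))"
  define \<psi> :: "complex \<times> complex \<times> (complex ^ 2) \<Rightarrow> complex \<times> complex \<times> 'v"
    where "\<psi> = (\<lambda>(l, m, v). (c * l, m / c, v $ 1 *\<^sub>C e + v $ 2 *\<^sub>C f))"
  have \<phi>: "\<phi> (l, m, x) = (l / c, c * m, vector [form Q x f, form Q x e])" for l m x
    by (simp add: \<phi>_def)
  have g4_carrier: "carrier g4 = UNIV"
    and g4_form: "form g4 (l, m, v) (l', m', w) = l * m' + m * l' + (v $ 1 * w $ 2 + v $ 2 * w $ 1)"
    and g4_bracket: "bracket g4 (l, m, v) (l', m', w) =
      (v $ 1 * w $ 2 - v $ 2 * w $ 1, 0, vector [m * w $ 1 - m' * v $ 1, m' * v $ 2 - m * w $ 2])"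
    for l m v l' m' w
    by (simp_all add: g4_def double_extension_def matrix_vector_mult_def sum_2 vec_eq_iff forall_2
        vector_2 scaleC_vec_def scaleC_complex_def)
  have form_coords: "form Q x y = form Q x f * form Q y e + form Q x e * form Q y f"
    if "x \<in> complex_vector.span {e, f}" "y \<in> carrier Q" for x y
  proof -
    have "form Q x y = form Q (plane_proj Q e f x) y" using plane_proj_id that by simp
    then show ?thesis
      using that by (simp add: plane_proj_def form_simps form_sym[of e y] form_sym[of f y])
  qed
  have "bij_betw \<phi> (carrier P.DE) (carrier g4)"
  proof (rule bij_betw_byWitness[where f' = \<psi>])
    show "\<forall>p\<in>carrier P.DE. \<psi> (\<phi> p) = p"
      using c_nonzero plane_proj_id
      by (auto simp: \<phi>_def \<psi>_def P.DE_carrier car vector_2 plane_proj_def)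
    show "\<forall>p\<in>carrier g4. \<phi> (\<psi> p) = p"
      using c_nonzero
      by (auto simp: \<phi>_def \<psi>_def vec_eq_iff forall_2 vector_2 pair_simps)
    show "\<psi> ` carrier g4 \<subseteq> carrier P.DE"
      by (auto simp: \<psi>_def P.DE_carrier car intro!: in_plane_iff[THEN iffD2])
  qed (simp add: g4_carrier)
  moreover have "clinear_on (carrier P.DE) \<phi>"
    by (rule clinear_onI)
      (auto simp: \<phi> P.DE_carrier car scaleC_Pair scaleC_vec_def vec_eq_iff forall_2 vector_2
        sub form_simps add_divide_distrib algebra_simps)
  moreover have "\<phi> (bracket P.DE p q) = bracket g4 (\<phi> p) (\<phi> q)
      \<and> form g4 (\<phi> p) (\<phi> q) = form P.DE p q"
    if pq: "p \<in> carrier P.DE" "q \<in> carrier P.DE" for p q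
  proof -
    obtain l m x l' m' y where [simp]: "p = (l, m, x)" "q = (l', m', y)"
      by (cases p, cases q) auto
    have xy: "x \<in> complex_vector.span {e, f}" "y \<in> complex_vector.span {e, f}"
      using pq by (auto simp: P.DE_carrier car)
    then have cx: "C x \<in> complex_vector.span {e, f}"
      using P.map_closed[of x] car by simp
    have "form Q (C x) y = c * (form Q x f * form Q y e - form Q x e * form Q y f)"
      using form_coords[OF cx sub[OF xy(2)]] xy
      by (simp add: sub form_map_e form_map_f algebra_simps)
    then have "form Q (C x) y / c = form Q x f * form Q y e - form Q x e * form Q y f"
      using c_nonzero by simp
    then show ?thesis
      using xy c_nonzero
      by (simp add: \<phi> P.DE_simps fm g4_bracket g4_form vector_2 vec_eq_iff forall_2 sub
          form_simps form_map_e form_map_f form_coords[OF xy(1) sub[OF xy(2)]] algebra_simps)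
  qed
  ultimately show ?thesis
    unfolding i_isomorphic_def i_isomorphism_def by blast
qed

lemma singular_double_extension_plane:
  "singular_quadratic_lie_algebra (double_extension (plane Q e f) C)"
proof -
  interpret P: skew_quadratic_space "plane Q e f" C by (rule skew_quadratic_space_plane)
  have "e \<noteq> 0" using form_ef by (auto simp: form_simps)
  then have "C e \<noteq> 0" using c_nonzero by (simp add: eigen_e)
  then show ?thesis
    by (intro P.singular_double_extension[of e]) (simp_all add: plane_def complex_vector.span_base)
qed

end


section \<open>Splitting a diagonalizable skew-symmetric map\<close>

text \<open>
  The component of \<open>x\<close> orthogonal to the planes found so far.
\<close>

definition residue ::
    "('v::complex_vector, 'm) quad_space_scheme \<Rightarrow> nat \<Rightarrow> (nat \<Rightarrow> 'v) \<Rightarrow> (nat \<Rightarrow> 'v) \<Rightarrow> 'v \<Rightarrow> 'v"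
  where "residue Q k e f x = x - (\<Sum>i<k. plane_proj Q (e i) (f i) x)"

locale hyperbolic_system = skew_quadratic_space Q C
  for Q :: "('v::complex_vector) quad_space" and C +
  fixes k :: nat and e f :: "nat \<Rightarrow> 'v" and c :: "nat \<Rightarrow> complex"
  assumes pair: "i < k \<Longrightarrow> hyperbolic_eigenpair Q C (e i) (f i) (c i)"
    and orthogonal: "i < k \<Longrightarrow> j < k \<Longrightarrow> i \<noteq> j \<Longrightarrow>
      form Q (e i) (e j) = 0 \<and> form Q (e i) (f j) = 0 \<and>
      form Q (f i) (e j) = 0 \<and> form Q (f i) (f j) = 0"
begin

lemma ef_mem [simp]: "i < k \<Longrightarrow> e i \<in> carrier Q" "i < k \<Longrightarrow> f i \<in> carrier Q"
  using hyperbolic_eigenpair.e_mem[OF pair] hyperbolic_eigenpair.f_mem[OF pair] by auto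

abbreviation "proj i \<equiv> plane_proj Q (e i) (f i)"
abbreviation "rest \<equiv> residue Q k e f"

lemma proj_closed [simp]: "i < k \<Longrightarrow> proj i x \<in> carrier Q"
  by (rule hyperbolic_eigenpair.plane_proj_closed[OF pair])

lemma form_plane_other:
  assumes "i < k" "j < k" "i \<noteq> j" "y \<in> complex_vector.span {e i, f i}"
  shows "form Q y (e j) = 0" "form Q y (f j) = 0"
  using assms orthogonal[of i j] by (auto simp: in_plane_iff form_simps)

lemma rest_closed [simp]: "x \<in> carrier Q \<Longrightarrow> rest x \<in> carrier Q"
  unfolding residue_def
  by (intro carrier_closed complex_vector.subspace_sum[OF carrier_subspace]) simp_all

lemma rest_linear: "clinear_on (carrier Q) rest"
  by (rule clinear_onI)
    (simp_all add: residue_def clinear_on_add[OF hyperbolic_eigenpair.plane_proj_linear[OF pair]]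
      clinear_on_scale[OF hyperbolic_eigenpair.plane_proj_linear[OF pair]]
      sum.distrib complex_vector.scale_sum_right complex_vector.scale_right_diff_distrib)

lemma form_rest:
  assumes x: "x \<in> carrier Q" and j: "j < k"
  shows "form Q (rest x) (e j) = 0" "form Q (rest x) (f j) = 0"
proof -
  have *: "form Q (rest x) y = form Q x y - (\<Sum>i<k. form Q (proj i x) y)" if "y \<in> carrier Q" for y
    using x that clinear_on_sum[OF form_clinear_left[OF that] carrier_subspace, of "{..<k}" "\<lambda>i. proj i x"]
      complex_vector.subspace_sum[OF carrier_subspace, of "{..<k}" "\<lambda>i. proj i x"]
    by (simp add: residue_def form_simps)
  have "(\<Sum>i<k. form Q (proj i x) y) = form Q x y" if y: "y = e j \<or> y = f j" for y
  proof -
    have "(\<Sum>i<k. form Q (proj i x) y) = (\<Sum>i<k. if i = j then form Q x y else 0)"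
      using y j form_plane_other[OF _ j _ hyperbolic_eigenpair.plane_proj_in_plane[OF pair]]
        hyperbolic_eigenpair.form_plane_proj[OF pair[OF j] x]
      by (intro sum.cong refl) auto
    then show ?thesis using j by simp
  qed
  then show "form Q (rest x) (e j) = 0" "form Q (rest x) (f j) = 0"
    using * j by simp_all
qed

lemma map_rest:
  assumes "x \<in> carrier Q"
  shows "C (rest x) = rest (C x)"
  using assms clinear_on_sum[OF map_linear carrier_subspace, of "{..<k}" "\<lambda>i. proj i x"]
    complex_vector.subspace_sum[OF carrier_subspace, of "{..<k}" "\<lambda>i. proj i x"]
  by (simp add: residue_def map_simps hyperbolic_eigenpair.map_plane_proj[OF pair])

lemma form_rest_rest:
  assumes x: "x \<in> carrier Q" and y: "y \<in> carrier Q"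
  shows "form Q (rest x) (rest y) = form Q (rest x) y"
proof -
  have "form Q (rest x) (\<Sum>i<k. proj i y) = (\<Sum>i<k. form Q (rest x) (proj i y))"
    using x by (intro clinear_on_sum[OF form_linear carrier_subspace]) simp_all
  also have "\<dots> = 0"
    using x form_rest[OF x] by (intro sum.neutral) (simp add: plane_proj_def form_simps)
  finally show ?thesis
    using x y complex_vector.subspace_sum[OF carrier_subspace, of "{..<k}" "\<lambda>i. proj i y"]
    by (simp add: residue_def[of Q k e f y] form_simps)
qed

text \<open>
  Let \<open>s\<close> be an eigenvector not exhausted by the system.  As \<open>rest\<close> is an orthogonal projection
  commuting with \<open>C\<close>, it maps eigenvectors to eigenvectors or to \<open>0\<close>, so \<open>rest s\<close> and a suitable
  \<open>rest t\<close> with \<open>t \<in> S\<close> serve as a new pair, automatically orthogonal to the old ones.  The last two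
  conclusions measure progress: the enlarged system exhausts \<open>s\<close> and everything exhausted before.
\<close>

lemma extend_by_eigenvector:
  assumes S: "complex_vector.span S = carrier Q" and eig: "\<forall>v\<in>S. \<exists>c. C v = c *\<^sub>C v"
    and ker: "\<forall>x\<in>carrier Q. \<forall>y\<in>carrier Q. C x = 0 \<longrightarrow> C y = 0 \<longrightarrow> form Q x y = 0"
    and s: "s \<in> S" "rest s \<noteq> 0"
  shows "\<exists>e' f' c'. hyperbolic_system Q C (Suc k) e' f' c' \<and> residue Q (Suc k) e' f' s = 0 \<and>
    (\<forall>t\<in>carrier Q. rest t = 0 \<longrightarrow> residue Q (Suc k) e' f' t = 0)"
proof -
  have Sc: "t \<in> carrier Q" if "t \<in> S" for t
    using that S complex_vector.span_base by blast
  define u where "u = rest s"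
  have u: "u \<in> carrier Q" "u \<noteq> 0" using s Sc by (auto simp: u_def)
  have rest_eig: "\<exists>a. C (rest t) = a *\<^sub>C rest t" if "t \<in> S" for t
    using eig that map_rest[OF Sc[OF that]] clinear_on_scale[OF rest_linear Sc[OF that]] by metis
  obtain a where a: "C u = a *\<^sub>C u" using rest_eig s unfolding u_def by blast
  \<comment> \<open>Non-degeneracy, tested on the spanning set \<open>S\<close>.\<close>
  obtain t where t: "t \<in> S" "form Q u t \<noteq> 0"
  proof -
    have "\<exists>t\<in>S. form Q u t \<noteq> 0"
    proof (rule ccontr)
      assume "\<not> (\<exists>t\<in>S. form Q u t \<noteq> 0)"
      then have "form Q u y = 0" if "y \<in> carrier Q" for y
        using clinear_on_eq_zero_on_span[of S "form Q u" y] form_linear[OF u(1)] that S by auto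
      then show False using form_nondegenerate u by blast
    qed
    then show ?thesis using that by blast
  qed
  have w: "rest t \<in> carrier Q" "form Q u (rest t) = form Q u t"
    using form_rest_rest Sc s t unfolding u_def by auto
  obtain b where b: "C (rest t) = b *\<^sub>C rest t" using rest_eig t by blast
  \<comment> \<open>Both sides of skew-symmetry \<open>B(C u, w) = - B(u, C w)\<close> for \<open>w = rest t\<close>.\<close>
  have "(a + b) * form Q u t = 0"
    using skew[OF u(1) w(1)] u w by (simp add: a b form_simps algebra_simps)
  then have ba: "b = - a" using t by (simp add: add_eq_0_iff)
  \<comment> \<open>Otherwise \<open>u\<close> and \<open>rest t\<close> lie in the isotropic kernel, yet they pair non-trivially.\<close>
  have a0: "a \<noteq> 0"
  proof
    assume "a = 0"
    then show False using ker u(1) w t a b ba by simp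
  qed
  have isotropic: "form Q x x = 0" if "x \<in> carrier Q" "C x = d *\<^sub>C x" "d \<noteq> 0" for x d
    using form_map_self[OF that(1)] that by (simp add: form_simps)
  define v where "v = inverse (form Q u t) *\<^sub>C rest t"
  have v: "v \<in> carrier Q" "form Q u v = 1" "C v = - a *\<^sub>C v"
    using u w t ba b by (simp_all add: v_def form_simps map_simps scaleC_scaleC mult.commute)
  have hyp: "hyperbolic_eigenpair Q C u v a"
    using u v a a0 isotropic[OF u(1) a a0] isotropic[OF v(1,3)] by unfold_locales simp_all
  interpret uv: hyperbolic_eigenpair Q C u v a by (rule hyp)
  have orth: "form Q u (e j) = 0" "form Q u (f j) = 0" "form Q v (e j) = 0" "form Q v (f j) = 0"
    "form Q (e j) u = 0" "form Q (f j) u = 0" "form Q (e j) v = 0" "form Q (f j) v = 0"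
    if "j < k" for j
  proof -
    show 1: "form Q u (e j) = 0" "form Q u (f j) = 0" "form Q v (e j) = 0" "form Q v (f j) = 0"
      using form_rest[OF _ that] Sc s t w that by (auto simp: u_def v_def form_simps)
    show "form Q (e j) u = 0" "form Q (f j) u = 0" "form Q (e j) v = 0" "form Q (f j) v = 0"
      using 1 u v that form_sym by (metis ef_mem)+
  qed
  let ?e = "e(k := u)" and ?f = "f(k := v)" and ?c = "c(k := a)"
  have sys: "hyperbolic_system Q C (Suc k) ?e ?f ?c"
  proof (intro hyperbolic_system.intro hyperbolic_system_axioms.intro)
    show "skew_quadratic_space Q C" by unfold_locales
    show "hyperbolic_eigenpair Q C (?e i) (?f i) (?c i)" if "i < Suc k" for i
      using that pair hyp by (cases "i = k") simp_all
    show "form Q (?e i) (?e j) = 0 \<and> form Q (?e i) (?f j) = 0 \<and>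
        form Q (?f i) (?e j) = 0 \<and> form Q (?f i) (?f j) = 0"
      if "i < Suc k" "j < Suc k" "i \<noteq> j" for i j
      using that orth[of i] orth[of j] orthogonal[of i j]
      by (cases "i = k"; cases "j = k") simp_all
  qed
  \<comment> \<open>The new plane is orthogonal to the old ones, so its component may be removed from the rest.\<close>
  have new: "residue Q (Suc k) ?e ?f x = rest x - plane_proj Q u v (rest x)"
    if x: "x \<in> carrier Q" for x
  proof -
    have "form Q (\<Sum>i<k. proj i x) y = 0" if y: "y = u \<or> y = v" for y
    proof -
      have yc: "y \<in> carrier Q" using y u v by auto
      have "form Q (\<Sum>i<k. proj i x) y = (\<Sum>i<k. form Q (proj i x) y)"
        by (intro clinear_on_sum[OF form_clinear_left[OF yc] carrier_subspace]) simp
      also have "\<dots> = 0"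
        using y yc orth by (intro sum.neutral) (auto simp: plane_proj_def form_simps)
      finally show ?thesis .
    qed
    then have "plane_proj Q u v (rest x) = plane_proj Q u v x"
      using x u v complex_vector.subspace_sum[OF carrier_subspace, of "{..<k}" "\<lambda>i. proj i x"]
      by (simp add: plane_proj_def residue_def form_simps)
    then show ?thesis by (simp add: residue_def)
  qed
  have "plane_proj Q u v u = u"
    by (rule uv.plane_proj_id) (simp add: complex_vector.span_base)
  then have s0: "residue Q (Suc k) ?e ?f s = 0"
    using new[OF Sc[OF s(1)]] by (simp add: u_def)
  have "plane_proj Q u v 0 = 0"
    using clinear_on_zero[OF uv.plane_proj_linear] by simp
  then have "\<forall>t\<in>carrier Q. rest t = 0 \<longrightarrow> residue Q (Suc k) ?e ?f t = 0"
    using new by simp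
  then show ?thesis
    using sys s0 by (intro exI[of _ ?e] exI[of _ ?f] exI[of _ ?c]) simp
qed

end

context skew_quadratic_space
begin

text \<open>
  By induction over the finite subsets \<open>F\<close> of an eigenbasis, some system exhausts all of \<open>F\<close>: one
  further pair per eigenvector is always enough.
\<close>

lemma exists_complete_hyperbolic_system:
  assumes diag: "diagonalizable_on (carrier Q) C"
    and ker: "\<forall>x\<in>carrier Q. \<forall>y\<in>carrier Q. C x = 0 \<longrightarrow> C y = 0 \<longrightarrow> form Q x y = 0"
  shows "\<exists>k e f c. hyperbolic_system Q C k e f c \<and>
    (\<forall>x\<in>carrier Q. x = (\<Sum>i<k. plane_proj Q (e i) (f i) x))"
proof -
  obtain S where S: "complex_vector.independent S" "complex_vector.span S = carrier Q"
    "\<forall>v\<in>S. \<exists>c. C v = c *\<^sub>C v"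
    using diag unfolding diagonalizable_on_def by blast
  have Sc: "S \<subseteq> carrier Q" using S complex_vector.span_superset by blast
  have "finite S"
    using finite_dim complex_vector.independent_span_bound[OF _ S(1)] Sc
    unfolding finite_dim_def by blast
  have "\<exists>k e f c. hyperbolic_system Q C k e f c \<and> (\<forall>s\<in>F. residue Q k e f s = 0)"
    if "finite F" "F \<subseteq> S" for F
    using that
  proof (induction F rule: finite_induct)
    case empty
    have "hyperbolic_system Q C 0 e f c" for e f c by unfold_locales auto
    then show ?case by blast
  next
    case (insert s F)
    then obtain k e f c
      where sys: "hyperbolic_system Q C k e f c" and F: "\<forall>s\<in>F. residue Q k e f s = 0"
      by auto
    show ?case
    proof (cases "residue Q k e f s = 0")
      case True
      then show ?thesis using sys F by blast
    next
      case False
      then obtain e' f' c' where "hyperbolic_system Q C (Suc k) e' f' c'"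
        "residue Q (Suc k) e' f' s = 0"
        "\<forall>t\<in>carrier Q. residue Q k e f t = 0 \<longrightarrow> residue Q (Suc k) e' f' t = 0"
        using hyperbolic_system.extend_by_eigenvector[OF sys S(2,3) ker _ False] insert.prems by blast
      moreover have "F \<subseteq> carrier Q" using insert.prems Sc by blast
      ultimately show ?thesis using F by blast
    qed
  qed
  then obtain k e f c
    where sys: "hyperbolic_system Q C k e f c" and zero: "\<forall>s\<in>S. residue Q k e f s = 0"
    using \<open>finite S\<close> by blast
  have "x = (\<Sum>i<k. plane_proj Q (e i) (f i) x)" if "x \<in> carrier Q" for x
    using clinear_on_eq_zero_on_span[of S "residue Q k e f" x]
      hyperbolic_system.rest_linear[OF sys] zero S(2) that
    by (simp add: residue_def)
  then show ?thesis using sys by blast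
qed

end

text \<open>
  The isomorphism sends \<open>x\<close> to the family of its components in the planes, with the sum as inverse.
  It respects the form because the planes are mutually orthogonal, and the bracket because every
  projection commutes with \<open>C\<close>.
\<close>

lemma (in hyperbolic_system) double_extension_amalgamated:
  assumes complete: "\<forall>x\<in>carrier Q. x = (\<Sum>i<k. proj i x)"
  shows "i_isomorphic DE (amalgamated_product k (\<lambda>i. plane Q (e i) (f i)) (\<lambda>i. C))"
proof -
  let ?A = "amalgamated_product k (\<lambda>i. plane Q (e i) (f i)) (\<lambda>i. C)"
  define \<phi> :: "complex \<times> complex \<times> 'v \<Rightarrow> complex \<times> complex \<times> (nat \<Rightarrow> 'v)"
    where "\<phi> = (\<lambda>(l, m, x). (l, m, \<lambda>i. if i < k then proj i x else 0))"
  define \<psi> :: "complex \<times> complex \<times> (nat \<Rightarrow> 'v) \<Rightarrow> complex \<times> complex \<times> 'v"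
    where "\<psi> = (\<lambda>(l, m, h). (l, m, \<Sum>i<k. h i))"
  have A_carrier: "carrier ?A = UNIV \<times> UNIV \<times>
      {h. (\<forall>i<k. h i \<in> complex_vector.span {e i, f i}) \<and> (\<forall>i\<ge>k. h i = 0)}"
    and A_form: "form ?A (l, m, h) (l', m', h') = l * m' + m * l' + (\<Sum>i<k. form Q (h i) (h' i))"
    and A_bracket: "bracket ?A (l, m, h) (l', m', h') =
      (\<Sum>i<k. form Q (C (h i)) (h' i), 0,
       \<lambda>i. if i < k then m *\<^sub>C C (h' i) - m' *\<^sub>C C (h i) else 0)"
    for l m h l' m' h'
    by (simp_all add: amalgamated_product_def double_extension_def orthogonal_sum_def plane_def
        direct_sum_map_def scaleC_fun_def fun_eq_iff)
  have proj_plane: "proj i x \<in> complex_vector.span {e i, f i}" if "i < k" for i x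
    by (rule hyperbolic_eigenpair.plane_proj_in_plane[OF pair[OF that]])
  have plane_sub: "y \<in> carrier Q" if "i < k" "y \<in> complex_vector.span {e i, f i}" for i y
    using hyperbolic_eigenpair.plane_subset[OF pair[OF that(1)]] that by blast
  have lin: "clinear_on (carrier Q) (proj i)" if "i < k" for i
    by (rule hyperbolic_eigenpair.plane_proj_linear[OF pair[OF that]])
  have proj_sum: "proj j (\<Sum>i<k. h i) = h j"
    if j: "j < k" and h: "\<And>i. i < k \<Longrightarrow> h i \<in> complex_vector.span {e i, f i}" for j h
  proof -
    have "proj j (\<Sum>i<k. h i) = (\<Sum>i<k. proj j (h i))"
      using plane_sub h by (intro clinear_on_sum[OF lin[OF j] carrier_subspace]) simp
    also have "\<dots> = (\<Sum>i<k. if i = j then h j else 0)"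
    proof (intro sum.cong refl)
      fix i assume i: "i \<in> {..<k}"
      show "proj j (h i) = (if i = j then h j else 0)"
        using hyperbolic_eigenpair.plane_proj_id[OF pair[OF j] h[OF j]]
          form_plane_other[OF _ j _ h] i
        by (auto simp: plane_proj_def)
    qed
    finally show ?thesis using j by simp
  qed
  have parseval: "(\<Sum>i<k. form Q (proj i x) (proj i y)) = form Q x y"
    if xy: "x \<in> carrier Q" "y \<in> carrier Q" for x y
  proof -
    have "form Q x y = form Q (\<Sum>i<k. proj i x) y" using complete xy by simp
    also have "\<dots> = (\<Sum>i<k. form Q (proj i x) y)"
      using xy by (intro clinear_on_sum[OF form_clinear_left carrier_subspace]) simp_all
    finally show ?thesis
      using xy hyperbolic_eigenpair.form_plane_proj_plane_proj[OF pair] by simp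
  qed
  have "bij_betw \<phi> (carrier DE) (carrier ?A)"
  proof (rule bij_betw_byWitness[where f' = \<psi>])
    show "\<forall>p\<in>carrier DE. \<psi> (\<phi> p) = p"
      using complete by (auto simp: \<phi>_def \<psi>_def DE_carrier)
    show "\<forall>p\<in>carrier ?A. \<phi> (\<psi> p) = p"
      using proj_sum by (auto simp: \<phi>_def \<psi>_def A_carrier fun_eq_iff)
    show "\<phi> ` carrier DE \<subseteq> carrier ?A"
      using proj_plane by (auto simp: \<phi>_def A_carrier)
    show "\<psi> ` carrier ?A \<subseteq> carrier DE"
      using plane_sub
      by (auto simp: \<psi>_def A_carrier DE_carrier
          intro!: complex_vector.subspace_sum[OF carrier_subspace])
  qed
  moreover have "clinear_on (carrier DE) \<phi>"
    by (rule clinear_onI)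
      (auto simp: \<phi>_def DE_simps scaleC_fun_def fun_eq_iff clinear_on_add[OF lin]
        clinear_on_scale[OF lin])
  moreover have "\<phi> (bracket DE p q) = bracket ?A (\<phi> p) (\<phi> q) \<and> form ?A (\<phi> p) (\<phi> q) = form DE p q"
    if pq: "p \<in> carrier DE" "q \<in> carrier DE" for p q
  proof -
    obtain l m x l' m' y where [simp]: "p = (l, m, x)" "q = (l', m', y)"
      by (cases p, cases q) auto
    have xy: "x \<in> carrier Q" "y \<in> carrier Q" using pq by (auto simp: DE_carrier)
    have "proj i (m *\<^sub>C C y - m' *\<^sub>C C x) = m *\<^sub>C C (proj i y) - m' *\<^sub>C C (proj i x)"
      if "i < k" for i
      using xy that clinear_on_diff[OF lin[OF that] carrier_subspace] clinear_on_scale[OF lin[OF that]]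
        hyperbolic_eigenpair.map_plane_proj[OF pair[OF that]]
      by simp
    moreover have "(\<Sum>i<k. form Q (C (proj i x)) (proj i y)) = form Q (C x) y"
      using xy parseval[of "C x" y] hyperbolic_eigenpair.map_plane_proj[OF pair] by simp
    ultimately show ?thesis
      using parseval[OF xy] by (simp add: \<phi>_def DE_form DE_bracket A_form A_bracket fun_eq_iff)
  qed
  ultimately show ?thesis
    unfolding i_isomorphic_def i_isomorphism_def by blast
qed


section \<open>The decomposition\<close>

theorem proposition6p11:
  fixes g :: "('v::complex_vector) quad_lie"
  assumes "singular_quadratic_lie_algebra g"
    and "is_reduced g"
    and "diagonalizable g"
  shows "\<exists>k (Q :: nat \<Rightarrow> 'v quad_space) (C :: nat \<Rightarrow> 'v \<Rightarrow> 'v).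
           k \<ge> 1 \<and>
           (\<forall>i<k. quadratic_space (Q i) \<and> skew_symmetric_map (Q i) (C i) \<and>
                  singular_quadratic_lie_algebra (double_extension (Q i) (C i)) \<and>
                  i_isomorphic (double_extension (Q i) (C i)) g4) \<and>
           i_isomorphic g (amalgamated_product k Q C)"
proof -
  obtain X0 Y0 W where ext: "is_double_extension_of g X0 Y0 W"
    and diag: "diagonalizable_on W (bracket g Y0)"
    using assms(3) unfolding diagonalizable_def by blast
  define Q :: "'v quad_space" where "Q = \<lparr> carrier = W, form = form g \<rparr>"
  define C where "C = bracket g Y0"
  define \<Phi> where "\<Phi> = (\<lambda>(l, m, x). x + l *\<^sub>C X0 + m *\<^sub>C Y0)"
  have W: "carrier Q = W" and fQ: "form Q = form g" by (simp_all add: Q_def)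
  have "quadratic_space Q" "skew_symmetric_map Q C"
    and \<Phi>: "i_isomorphism (double_extension Q C) g \<Phi>"
    using ext unfolding is_double_extension_of_def Let_def Q_def C_def \<Phi>_def by auto
  then interpret skew_quadratic_space Q C
    by (simp add: skew_quadratic_space_def skew_quadratic_space_axioms_def)
  have bij: "bij_betw \<Phi> (carrier DE) (carrier g)"
    and br: "\<And>p q. p \<in> carrier DE \<Longrightarrow> q \<in> carrier DE \<Longrightarrow>
      bracket g (\<Phi> p) (\<Phi> q) = \<Phi> (bracket DE p q)"
    using \<Phi> unfolding i_isomorphism_def by auto
  have onto: "\<exists>p\<in>carrier DE. y = \<Phi> p" if "y \<in> carrier g" for y
    using bij that by (auto simp: bij_betw_def)
  have \<Phi>0: "\<Phi> 0 = 0" by (simp add: \<Phi>_def zero_prod_def)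
  \<comment> \<open>The kernel of \<open>C\<close> is central, hence isotropic as \<open>g\<close> is reduced.\<close>
  have ker_center: "x \<in> center g" if x: "x \<in> carrier Q" "C x = 0" for x
  proof -
    have p: "(0, 0, x) \<in> carrier DE" "\<Phi> (0, 0, x) = x"
      using x by (auto simp: DE_carrier \<Phi>_def)
    have "bracket g x y = 0" if "y \<in> carrier g" for y
    proof -
      obtain l m z where z: "(l, m, z) \<in> carrier DE" "y = \<Phi> (l, m, z)"
        using onto \<open>y \<in> carrier g\<close> by (metis prod_cases3)
      then have "bracket DE (0, 0, x) (l, m, z) = 0"
        using x by (auto simp: DE_simps form_simps zero_prod_def)
      then show ?thesis using br[OF p(1) z(1)] p z \<Phi>0 by simp
    qed
    moreover have "x \<in> carrier g" using p bij by (metis bij_betwE)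
    ultimately show ?thesis unfolding center_def by blast
  qed
  have "\<forall>x\<in>carrier Q. \<forall>y\<in>carrier Q. C x = 0 \<longrightarrow> C y = 0 \<longrightarrow> form Q x y = 0"
    using ker_center assms(2) unfolding is_reduced_def fQ by blast
  then obtain k e f c where "hyperbolic_system Q C k e f c"
    and complete: "\<forall>x\<in>carrier Q. x = (\<Sum>i<k. plane_proj Q (e i) (f i) x)"
    using exists_complete_hyperbolic_system diag unfolding W C_def by blast
  then interpret hyperbolic_system Q C k e f c by simp
  have "k \<ge> 1"
  proof (rule ccontr)
    assume "\<not> k \<ge> 1"
    then have "k = 0" by simp
    \<comment> \<open>Without any plane, \<open>W = 0\<close> and \<open>g\<close> is spanned by the commuting vectors \<open>X\<^sub>0\<close> and \<open>Y\<^sub>0\<close>.\<close>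
    then have W0: "x = 0" if "x \<in> carrier Q" for x using complete that by simp
    have "bracket DE p q = 0" if "p \<in> carrier DE" "q \<in> carrier DE" for p q
      using that by (auto simp: DE_simps zero_prod_def form_simps map_simps dest!: W0)
    then have "abelian g" unfolding abelian_def using onto br \<Phi>0 by metis
    then show False using assms(1) unfolding singular_quadratic_lie_algebra_def by blast
  qed
  moreover have "quadratic_space (plane Q (e i) (f i)) \<and> skew_symmetric_map (plane Q (e i) (f i)) C \<and>
      singular_quadratic_lie_algebra (double_extension (plane Q (e i) (f i)) C) \<and>
      i_isomorphic (double_extension (plane Q (e i) (f i)) C) g4" if "i < k" for i
  proof -
    interpret hyperbolic_eigenpair Q C "e i" "f i" "c i" by (rule pair[OF that])
    interpret P: skew_quadratic_space "plane Q (e i) (f i)" C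
      by (rule skew_quadratic_space_plane)
    show ?thesis
      by (intro conjI P.quadratic_space_axioms P.skew_map singular_double_extension_plane
          double_extension_plane_g4)
  qed
  moreover have "i_isomorphic g (amalgamated_product k (\<lambda>i. plane Q (e i) (f i)) (\<lambda>i. C))"
    using i_isomorphism_inverse[OF quadratic_lie_algebra_double_extension \<Phi>]
      double_extension_amalgamated[OF complete] i_isomorphism_comp
    unfolding i_isomorphic_def by blast
  ultimately show ?thesis
    by (intro exI[of _ k] exI[of _ "\<lambda>i. plane Q (e i) (f i)"] exI[of _ "\<lambda>i. C"]) simp
qed

end
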